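(* (Minkowski--Voronoi complex stabilization.) Let $a\ge 1$ and $\alpha\ge 1$ be integers and let $\beta,\gamma$ be integers with $$0\le \beta<\alpha a,\qquad 0\le\gamma<a,\qquad \gcd(\alpha,\beta)=1,\qquad \gcd(a,\alpha+\beta\gamma)=1 .$$ For nonnegative integers $t,u$ put $$b(t)=\alpha a t+\beta,\qquad N(t,u)=b(t)(au+\gamma)+\alpha=(\alpha a t+\beta)(au+\gamma)+\alpha,$$ and consider only parameter values $t\ge 0$ with $0<\alpha<b(t)$ (automatic for $t\ge 1$; for $t=0$ it means $\alpha<\beta$). Then: (1) ($(t,u)$-stabilization) there exist $t_0$ and $u_0$ such that for all $t>t_0$ and $u>u_0$ the complexes $MV\big(\Gamma(a,b(t),N(t,u))\big)$ and $MV\big(\Gamma(a,b(t_0),N(t_0,u_0))\big)$ are combinatorially equivalent; (2) ($t$-stabilization) for every $u\ge 0$ there exists $t_0$ such that for every $t>t_0$ the complexes $MV\big(\Gamma(a,b(t),N(t,u))\big)$ and $MV\big(\Gamma(a,b(t_0),N(t_0,u))\big)$ are combinatorially equivalent; (3) ($u$-stabilization) for every admissible $t\ge 0$ there exists $u_0$ such that for every $u>u_0$ the complexes $MV\big(\Gamma(a,b(t),N(t,u))\big)$ and $MV\big(\Gamma(a,b(t),N(t,u_0))\big)$ are combinatorially equivalent.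
   Context: For positive integers $a,b,N$ the rank-1 lattice is $\Gamma(a,b,N)=\{m_1(1,a,b)+m_2(0,N,0)+m_3(0,0,N): m_i\in\mathbb Z\}\subset\mathbb R^3$, and $|\Gamma|=\{(|x_1|,|x_2|,|x_3|):(x_1,x_2,x_3)\in\Gamma\}\setminus\{0\}\subset\mathbb R^3_{\ge0}$. For a finite set $A\subset\mathbb R^3_{\ge 0}$ let $\Pi(A)=\{(x_1,x_2,x_3): 0\le x_i\le \max\{y_i:(y_1,y_2,y_3)\in A\},\ i=1,2,3\}$. For a set $S\subset\mathbb R^3_{\ge0}$, a point $\gamma\in S$ is a Voronoi relative minimum if $\Pi(\{\gamma\})$ contains no point of $S\setminus\{\gamma\}$; $\mathrm{vrm}(S)$ denotes the set of these. A finite $F\subset \mathrm{vrm}(S)$ is minimal if $\Pi(F)$ contains no point of $\mathrm{vrm}(S)\setminus F$; $\mathfrak M_k(S)$ is the set of minimal $k$-element subsets. The Minkowski--Voronoi complex $MV(S)$ is the 2-dimensional complex whose $k$-dimensional faces are indexed by $\mathfrak M_{3-k}(S)$ ($k=0,1,2$), a face with subset $F_1$ being adjacent to a face with subset $F_2\neq F_1$ iff $F_1\subset F_2$. For a lattice $\Gamma$ with $\mathrm{vrm}(|\Gamma|)$ finite, $MV(\Gamma)$ denotes $MV(\mathrm{vrm}(|\Gamma|))$. Two such complexes are combinatorially equivalent if there is a bijection between their faces preserving dimension and adjacency (inclusion). *)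

theory Defs
  imports "HOL-Analysis.Analysis"
begin

definition rank1_lattice :: "int \<Rightarrow> int \<Rightarrow> int \<Rightarrow> (real^3) set" where
  "rank1_lattice a b N =
     {of_int m1 *\<^sub>R vector [1, of_int a, of_int b]
      + of_int m2 *\<^sub>R vector [0, of_int N, 0]
      + of_int m3 *\<^sub>R vector [0, 0, of_int N] | m1 m2 m3 :: int. True}"

definition abs_set :: "(real^3) set \<Rightarrow> (real^3) set" where
  "abs_set \<Gamma> = (\<lambda>x. \<chi> i. \<bar>x $ i\<bar>) ` \<Gamma> - {0}"

(* Meaningful only for finite nonempty A. *)
definition Pi_box :: "(real^3) set \<Rightarrow> (real^3) set" where
  "Pi_box A = {x. \<forall>i. 0 \<le> x $ i \<and> x $ i \<le> Max ((\<lambda>y. y $ i) ` A)}"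

definition vrm :: "(real^3) set \<Rightarrow> (real^3) set" where
  "vrm S = {\<gamma> \<in> S. Pi_box {\<gamma>} \<inter> (S - {\<gamma>}) = {}}"

definition minimal_subset :: "(real^3) set \<Rightarrow> (real^3) set \<Rightarrow> bool" where
  "minimal_subset S F \<longleftrightarrow> finite F \<and> F \<subseteq> vrm S \<and> Pi_box F \<inter> (vrm S - F) = {}"

definition minimal_subsets :: "nat \<Rightarrow> (real^3) set \<Rightarrow> (real^3) set set" where
  "minimal_subsets k S = {F. minimal_subset S F \<and> card F = k}"

(* An abstract complex: faces C k is the set of k-dimensional faces. *)
record 'f face_complex =
  faces :: "nat \<Rightarrow> 'f set"
  adjacent :: "'f \<Rightarrow> 'f \<Rightarrow> bool"

definition MV :: "(real^3) set \<Rightarrow> (real^3) set face_complex" where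
  "MV S = \<lparr> faces = (\<lambda>k. if k \<le> 2 then minimal_subsets (3 - k) S else {}),
            adjacent = (\<lambda>F1 F2. F1 \<noteq> F2 \<and> F1 \<subseteq> F2) \<rparr>"

definition MV_lattice :: "(real^3) set \<Rightarrow> (real^3) set face_complex" where
  "MV_lattice \<Gamma> = MV (vrm (abs_set \<Gamma>))"

definition combinatorially_equivalent :: "'f face_complex \<Rightarrow> 'g face_complex \<Rightarrow> bool" where
  "combinatorially_equivalent C D \<longleftrightarrow>
     (\<exists>f. bij_betw f (\<Union>k. faces C k) (\<Union>k. faces D k) \<and>
          (\<forall>k. \<forall>F \<in> faces C k. f F \<in> faces D k) \<and>
          (\<forall>F1 \<in> (\<Union>k. faces C k). \<forall>F2 \<in> (\<Union>k. faces C k).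
             adjacent C F1 F2 \<longleftrightarrow> adjacent D (f F1) (f F2)))"

end

theory Submission
  imports Defs
begin

text \<open>
  Write \<open>c = a u + \<gamma>\<close>, so that \<open>N = b c + \<alpha>\<close>. The points \<open>(1, a, b)\<close> and
  \<open>(c, a c, - \<alpha>)\<close> lie in the lattice, as do \<open>N\<close> times the unit vectors. A relative minimum
  \<open>x\<close> dominates none of them, so all \<open>\<bar>x\<^sub>i\<bar> \<le> N\<close> and one of the following holds:
  \<open>\<bar>x\<^sub>3\<bar> \<le> \<alpha>\<close>; \<open>\<bar>x\<^sub>2\<bar> \<le> a\<close>; \<open>\<bar>x\<^sub>3\<bar> \<le> b\<close> and \<open>\<bar>x\<^sub>2\<bar> \<le> a c\<close>;
  \<open>\<bar>x\<^sub>3\<bar> \<le> b\<close> and \<open>\<bar>x\<^sub>1\<bar> \<le> c\<close>. In each case \<open>x\<close> belongs to a finite list of families of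
  lattice points that is independent of \<open>t\<close> and \<open>u\<close>, with the first two coordinates in the span of
  \<open>1, c, b c\<close> and the third in the span of \<open>1, b, b c\<close>. Comparisons of absolute values of
  such coordinates are eventually constant in each of the three regimes, and the complex depends only
  on the coordinatewise orders of the finitely many candidates. If \<open>c = 0\<close>, then \<open>N = \<alpha>\<close> and
  the lattice does not depend on \<open>t\<close>.
\<close>

section \<open>Relative minima of sets with nonnegative coordinates\<close>

definition cabs :: "real^3 \<Rightarrow> real^3" where
  "cabs x = (\<chi> i. \<bar>x $ i\<bar>)"

lemma cabs_nth [simp]: "cabs x $ i = \<bar>x $ i\<bar>"
  by (simp add: cabs_def)

lemma cabs_eq_0_iff [simp]: "cabs x = 0 \<longleftrightarrow> x = 0"
  by (simp add: vec_eq_iff)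

lemma abs_set_eq: "abs_set \<Gamma> = cabs ` \<Gamma> - {0}"
  by (simp add: abs_set_def cabs_def)

lemma abs_set_nonneg: "x \<in> abs_set \<Gamma> \<Longrightarrow> 0 \<le> x $ i"
  by (auto simp: abs_set_eq)

lemma mem_vrm_iff:
  assumes "\<And>x i. x \<in> S \<Longrightarrow> 0 \<le> x $ i"
  shows "v \<in> vrm S \<longleftrightarrow> v \<in> S \<and> (\<forall>w\<in>S. (\<forall>i. w $ i \<le> v $ i) \<longrightarrow> w = v)"
proof -
  have "w \<in> Pi_box {v} \<longleftrightarrow> (\<forall>i. w $ i \<le> v $ i)" if "w \<in> S" for w
    using assms[OF that] by (simp add: Pi_box_def)
  then show ?thesis
    unfolding vrm_def by blast
qed

lemma vrm_subset: "vrm S \<subseteq> S"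
  by (auto simp: vrm_def)

text \<open>\<open>MV_lattice\<close> hands \<open>vrm (abs_set \<Gamma>)\<close> to
  \<open>MV\<close>, whose faces apply \<open>vrm\<close> once more; idempotence collapses the
  two.\<close>

lemma vrm_idem: "vrm (vrm S) = vrm S"
  by (auto simp: vrm_def)

lemma mem_Pi_box_iff:
  assumes "finite F" "F \<noteq> {}" "\<And>i. 0 \<le> x $ i"
  shows "x \<in> Pi_box F \<longleftrightarrow> (\<forall>i. \<exists>y\<in>F. x $ i \<le> y $ i)"
  using assms by (auto simp: Pi_box_def Max_ge_iff)

text \<open>Descent: a point that is not a relative minimum dominates a different point of
  \<open>S\<close>, whose coordinate sum is a strictly smaller nonnegative integer.\<close>

lemma vrm_below:
  assumes nonneg: "\<And>x i. x \<in> S \<Longrightarrow> 0 \<le> x $ i"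
    and ints: "\<And>x i. x \<in> S \<Longrightarrow> x $ i \<in> \<int>"
    and "x \<in> S"
  shows "\<exists>v\<in>vrm S. \<forall>i. v $ i \<le> x $ i"
  using \<open>x \<in> S\<close>
proof (induction "nat \<lfloor>\<Sum>i\<in>UNIV. x $ i\<rfloor>" arbitrary: x rule: less_induct)
  case less
  show ?case
  proof (cases "x \<in> vrm S")
    case False
    then obtain w where w: "w \<in> S" "\<And>i. w $ i \<le> x $ i" "w \<noteq> x"
      using less.prems mem_vrm_iff[OF nonneg] by metis
    obtain i where i: "w $ i < x $ i"
      using w by (metis order_le_less vec_eq_iff)
    have lt: "(\<Sum>i\<in>UNIV. w $ i) < (\<Sum>i\<in>UNIV. x $ i)"
      by (rule sum_strict_mono_ex1) (use w i in auto)
    have int: "of_int \<lfloor>\<Sum>i\<in>UNIV. y $ i\<rfloor> = (\<Sum>i\<in>UNIV. y $ i)" if "y \<in> S" for y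
      using ints that by (intro of_int_floor Ints_sum) auto
    have "\<lfloor>\<Sum>i\<in>UNIV. w $ i\<rfloor> < \<lfloor>\<Sum>i\<in>UNIV. x $ i\<rfloor>"
      using lt int[OF w(1)] int[OF less.prems] by linarith
    moreover have "0 \<le> \<lfloor>\<Sum>i\<in>UNIV. w $ i\<rfloor>"
      using nonneg[OF w(1)] by (simp add: sum_nonneg)
    ultimately obtain v where "v \<in> vrm S" "\<forall>i. v $ i \<le> w $ i"
      using less.hyps[of w] w(1) by (metis nat_less_eq_zless)
    then show ?thesis
      using w(2) order_trans by blast
  qed auto
qed

text \<open>This later replaces the infinite set of lattice points by a finite set \<open>T\<close>
  of candidates. A minimum of \<open>T\<close> dominates some minimum of \<open>S\<close>; the
  latter lies in \<open>T\<close>, so the two coincide.\<close>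

lemma vrm_eq_between:
  assumes nonneg: "\<And>x i. x \<in> S \<Longrightarrow> 0 \<le> x $ i"
    and ints: "\<And>x i. x \<in> S \<Longrightarrow> x $ i \<in> \<int>"
    and "vrm S \<subseteq> T" "T \<subseteq> S"
  shows "vrm T = vrm S"
proof
  show "vrm S \<subseteq> vrm T"
    using assms(3,4) by (auto simp: vrm_def)
  show "vrm T \<subseteq> vrm S"
  proof
    fix x assume x: "x \<in> vrm T"
    then have xS: "x \<in> S" using vrm_subset assms(4) by blast
    obtain v where v: "v \<in> vrm S" "\<forall>i. v $ i \<le> x $ i"
      using vrm_below[OF nonneg ints xS] by blast
    have "v = x"
      using x v assms(3,4) nonneg mem_vrm_iff[of T x] by blast
    with v show "x \<in> vrm S" by simp
  qed
qed

section \<open>Combinatorial equivalence from coordinatewise order isomorphisms\<close>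

lemma combinatorially_equivalent_refl: "combinatorially_equivalent C C"
  unfolding combinatorially_equivalent_def by (rule exI[of _ id]) auto

text \<open>Nonemptiness follows from the cardinality \<open>3 - k\<close>, which is positive for
  \<open>k \<le> 2\<close>; it is recorded because the \<open>Max\<close> in \<open>Pi_box\<close>
  is meaningful only for nonempty sets.\<close>

lemma mem_faces_MV_iff:
  assumes "vrm V = V"
  shows "F \<in> faces (MV V) k \<longleftrightarrow>
    k \<le> 2 \<and> finite F \<and> F \<noteq> {} \<and> F \<subseteq> V \<and> Pi_box F \<inter> (V - F) = {} \<and> card F = 3 - k"
proof -
  have "F \<noteq> {}" if "k \<le> 2" "card F = 3 - k"
    using that by auto
  then show ?thesis
    unfolding MV_def minimal_subsets_def minimal_subset_def assms by (simp, blast)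
qed

text \<open>Whether a point of \<open>V\<close> lies in \<open>Pi_box F\<close> depends only on
  coordinatewise comparisons inside \<open>V\<close>, so taking images under \<open>f\<close>
  carries faces to faces in both directions.\<close>

lemma MV_equivalent_of_order_iso:
  assumes nonneg: "\<And>x i. x \<in> V \<Longrightarrow> 0 \<le> x $ i" "\<And>x i. x \<in> V' \<Longrightarrow> 0 \<le> x $ i"
    and vrm: "vrm V = V" "vrm V' = V'"
    and bij: "bij_betw f V V'"
    and ord: "\<And>x y i. x \<in> V \<Longrightarrow> y \<in> V \<Longrightarrow> f x $ i \<le> f y $ i \<longleftrightarrow> x $ i \<le> y $ i"
  shows "combinatorially_equivalent (MV V) (MV V')"
proof -
  have inj: "inj_on f V" and im: "f ` V = V'"
    using bij by (auto simp: bij_betw_def)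
  have sub: "F \<subseteq> V" if "F \<in> faces (MV V) k" for F k
    using that by (simp add: mem_faces_MV_iff vrm)
  have sub': "F \<subseteq> V'" if "F \<in> faces (MV V') k" for F k
    using that by (simp add: mem_faces_MV_iff vrm)
  have face: "f ` F \<in> faces (MV V') k \<longleftrightarrow> F \<in> faces (MV V) k" if F: "F \<subseteq> V" for F k
  proof (cases "k \<le> 2 \<and> finite F \<and> F \<noteq> {}")
    case True
    have box: "f x \<in> Pi_box (f ` F) \<longleftrightarrow> x \<in> Pi_box F" if "x \<in> V" for x
    proof -
      have "f x \<in> Pi_box (f ` F) \<longleftrightarrow> (\<forall>i. \<exists>y\<in>f ` F. f x $ i \<le> y $ i)"
        using True that nonneg(2) im by (intro mem_Pi_box_iff) auto
      also have "\<dots> \<longleftrightarrow> (\<forall>i. \<exists>y\<in>F. x $ i \<le> y $ i)"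
        unfolding bex_simps using F that ord by (metis subsetD)
      also have "\<dots> \<longleftrightarrow> x \<in> Pi_box F"
        using True that nonneg(1) by (intro mem_Pi_box_iff[symmetric]) auto
      finally show ?thesis .
    qed
    have diff: "V' - f ` F = f ` (V - F)"
      using inj im F by (simp add: inj_on_image_set_diff)
    have "Pi_box (f ` F) \<inter> (V' - f ` F) = {} \<longleftrightarrow> (\<forall>x\<in>V - F. f x \<notin> Pi_box (f ` F))"
      unfolding diff by blast
    also have "\<dots> \<longleftrightarrow> (\<forall>x\<in>V - F. x \<notin> Pi_box F)"
      using box by simp
    also have "\<dots> \<longleftrightarrow> Pi_box F \<inter> (V - F) = {}"
      by blast
    finally have "Pi_box (f ` F) \<inter> (V' - f ` F) = {} \<longleftrightarrow> Pi_box F \<inter> (V - F) = {}" .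
    moreover have "card (f ` F) = card F"
      using inj F card_image inj_on_subset by blast
    moreover have "f ` F \<subseteq> V'"
      using F im by blast
    ultimately show ?thesis
      unfolding mem_faces_MV_iff[OF vrm(1)] mem_faces_MV_iff[OF vrm(2)] using True F by simp
  next
    case False
    have fin: "finite (f ` F) \<longleftrightarrow> finite F"
      using F inj finite_image_iff inj_on_subset by blast
    show ?thesis
      unfolding mem_faces_MV_iff[OF vrm(1)] mem_faces_MV_iff[OF vrm(2)] fin image_is_empty
      using False by argo
  qed
  have fwd: "f ` F \<in> faces (MV V') k" if "F \<in> faces (MV V) k" for F k
    using face[OF sub[OF that]] that by simp
  have inj_im: "inj_on ((`) f) (Pow V)"
    using inj by (rule inj_on_image_Pow)
  have "bij_betw ((`) f) (\<Union>k. faces (MV V) k) (\<Union>k. faces (MV V') k)"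
    unfolding bij_betw_def
  proof
    show "inj_on ((`) f) (\<Union>k. faces (MV V) k)"
      by (rule inj_on_subset[OF inj_im]) (use sub in auto)
    show "(`) f ` (\<Union>k. faces (MV V) k) = (\<Union>k. faces (MV V') k)"
    proof
      show "(`) f ` (\<Union>k. faces (MV V) k) \<subseteq> (\<Union>k. faces (MV V') k)"
        using fwd by auto
      show "(\<Union>k. faces (MV V') k) \<subseteq> (`) f ` (\<Union>k. faces (MV V) k)"
      proof
        fix G assume "G \<in> (\<Union>k. faces (MV V') k)"
        then obtain k where G: "G \<in> faces (MV V') k" by auto
        then obtain F where "F \<subseteq> V" "G = f ` F"
          using sub' im by (meson subset_image_iff)
        then show "G \<in> (`) f ` (\<Union>k. faces (MV V) k)"
          using G face[of F k] by auto
      qed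
    qed
  qed
  moreover have "\<forall>k. \<forall>F\<in>faces (MV V) k. f ` F \<in> faces (MV V') k"
    using fwd by simp
  moreover have "adjacent (MV V) F G \<longleftrightarrow> adjacent (MV V') (f ` F) (f ` G)"
    if "F \<subseteq> V" "G \<subseteq> V" for F G
    using inj_on_image_subset_iff[OF inj that] inj_on_image_eq_iff[OF inj that]
    by (simp add: MV_def)
  ultimately show ?thesis
    unfolding combinatorially_equivalent_def using sub
    by (intro exI[of _ "(`) f"] conjI ballI) (assumption | elim UN_E | simp)+
qed

text \<open>This compares the complexes of one index set evaluated at two parameter values. Equality
  of absolute values is a pair of comparisons, hence the same indices are identified on both sides;
  \<open>zero\<close> makes the removal of the origin agree as well.\<close>

lemma MV_vrm_equivalent_of_indexed:
  fixes e e' :: "'j \<Rightarrow> real^3"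
  assumes ord: "\<And>j k i. j \<in> J \<Longrightarrow> k \<in> J \<Longrightarrow>
      \<bar>e j $ i\<bar> \<le> \<bar>e k $ i\<bar> \<longleftrightarrow> \<bar>e' j $ i\<bar> \<le> \<bar>e' k $ i\<bar>"
    and zero: "\<And>j. j \<in> J \<Longrightarrow> e j = 0 \<longleftrightarrow> e' j = 0"
  shows "combinatorially_equivalent
    (MV (vrm (cabs ` e ` J - {0}))) (MV (vrm (cabs ` e' ` J - {0})))"
proof -
  define T T' where "T = cabs ` e ` J - {0}" and "T' = cabs ` e' ` J - {0}"
  \<comment> \<open>Several indices may give the same point; by \<open>eq\<close> below, the value
    does not depend on the one chosen.\<close>
  define f where "f x = cabs (e' (SOME j. j \<in> J \<and> cabs (e j) = x))" for x
  have eq: "cabs (e j) = cabs (e k) \<longleftrightarrow> cabs (e' j) = cabs (e' k)" if "j \<in> J" "k \<in> J" for j k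
    using ord[OF that] ord[OF that(2,1)] by (simp add: vec_eq_iff order_eq_iff)
  have f: "f (cabs (e j)) = cabs (e' j)" if "j \<in> J" for j
  proof -
    let ?k = "SOME k. k \<in> J \<and> cabs (e k) = cabs (e j)"
    have "?k \<in> J \<and> cabs (e ?k) = cabs (e j)"
      by (rule someI[of _ j]) (use that in auto)
    then show ?thesis
      using eq[of ?k j] that by (simp add: f_def)
  qed
  have T: "x \<in> T \<longleftrightarrow> (\<exists>j\<in>J. e j \<noteq> 0 \<and> x = cabs (e j))" for x
    by (auto simp: T_def)
  have T': "x \<in> T' \<longleftrightarrow> (\<exists>j\<in>J. e j \<noteq> 0 \<and> x = cabs (e' j))" for x
    using zero by (auto simp: T'_def)
  have nonneg: "0 \<le> x $ i" if "x \<in> T" for x i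
    using that by (auto simp: T)
  have nonneg': "0 \<le> x $ i" if "x \<in> T'" for x i
    using that by (auto simp: T')
  have inj: "inj_on f T"
    by (auto simp: inj_on_def T f eq)
  have im: "f ` T = T'"
  proof (intro equalityI subsetI)
    fix x assume "x \<in> f ` T"
    then obtain j where "j \<in> J" "e j \<noteq> 0" "x = f (cabs (e j))"
      by (auto simp: T)
    then show "x \<in> T'"
      using f by (auto simp: T')
  next
    fix x assume "x \<in> T'"
    then obtain j where j: "j \<in> J" "e j \<noteq> 0" "x = cabs (e' j)"
      by (auto simp: T')
    then have "cabs (e j) \<in> T" "x = f (cabs (e j))"
      using f by (auto simp: T)
    then show "x \<in> f ` T"
      by blast
  qed
  have le: "f x $ i \<le> f y $ i \<longleftrightarrow> x $ i \<le> y $ i" if "x \<in> T" "y \<in> T" for x y i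
    using that f ord by (auto simp: T)
  have vrm: "f x \<in> vrm T' \<longleftrightarrow> x \<in> vrm T" if "x \<in> T" for x
  proof -
    have "f x \<in> vrm T' \<longleftrightarrow> (\<forall>w\<in>T. (\<forall>i. f w $ i \<le> f x $ i) \<longrightarrow> f w = f x)"
      using that im by (subst mem_vrm_iff[OF nonneg']) auto
    also have "\<dots> \<longleftrightarrow> (\<forall>w\<in>T. (\<forall>i. w $ i \<le> x $ i) \<longrightarrow> w = x)"
      using that le inj by (simp add: inj_on_eq_iff)
    also have "\<dots> \<longleftrightarrow> x \<in> vrm T"
      using that by (subst mem_vrm_iff[OF nonneg]) auto
    finally show ?thesis .
  qed
  have "f ` vrm T = vrm T'"
    using vrm im vrm_subset[of T] vrm_subset[of T'] by blast
  then have "bij_betw f (vrm T) (vrm T')"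
    using inj_on_subset[OF inj vrm_subset] by (simp add: bij_betw_def)
  then show ?thesis
    unfolding T_def[symmetric] T'_def[symmetric]
    using vrm_subset[of T] vrm_subset[of T'] nonneg nonneg' le
    by (intro MV_equivalent_of_order_iso[where f = f]) (auto simp: vrm_idem subset_iff)
qed


section \<open>Functions whose sign is eventually constant along a filter\<close>

definition sgn_stable :: "'p filter \<Rightarrow> ('p \<Rightarrow> real) \<Rightarrow> bool" where
  "sgn_stable F f \<longleftrightarrow> (\<exists>s. \<forall>\<^sub>F p in F. sgn (f p) = s)"

lemma sgn_stable_uminus: "sgn_stable F (\<lambda>p. - f p) \<Longrightarrow> sgn_stable F f"
proof -
  assume "sgn_stable F (\<lambda>p. - f p)"
  then obtain s where "\<forall>\<^sub>F p in F. sgn (- f p) = s"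
    by (auto simp: sgn_stable_def)
  then have "\<forall>\<^sub>F p in F. sgn (f p) = - s"
    by eventually_elim (auto simp: sgn_minus)
  then show ?thesis
    by (auto simp: sgn_stable_def)
qed

lemma sgn_stable_const: "sgn_stable F (\<lambda>p. A)"
  unfolding sgn_stable_def by (intro exI[of _ "sgn A"]) simp

lemma sgn_stable_at_top: "filterlim f at_top F \<Longrightarrow> sgn_stable F f"
  unfolding sgn_stable_def filterlim_at_top_dense
  by (intro exI[of _ 1], erule allE[of _ 0]) (auto elim: eventually_mono)

text \<open>The comparison of absolute values is a sign condition on a product: \<bar>x\<bar> \<le>
  \<bar>y\<bar> iff (x - y)(x + y) \<le> 0.\<close>

lemma abs_le_stable:
  assumes "sgn_stable F (\<lambda>p. f p - g p)" "sgn_stable F (\<lambda>p. f p + g p)"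
  shows "\<exists>s. \<forall>\<^sub>F p in F. (\<bar>f p\<bar> \<le> \<bar>g p\<bar>) = s"
proof -
  obtain s r where ev: "\<forall>\<^sub>F p in F. sgn (f p - g p) = s" "\<forall>\<^sub>F p in F. sgn (f p + g p) = r"
    using assms by (auto simp: sgn_stable_def)
  have eq: "\<bar>x\<bar> \<le> \<bar>y\<bar> \<longleftrightarrow> sgn (x - y) * sgn (x + y) \<le> 0" for x y :: real
  proof -
    have "\<bar>x\<bar> \<le> \<bar>y\<bar> \<longleftrightarrow> (x - y) * (x + y) \<le> 0"
      by (simp add: abs_le_square_iff power2_eq_square algebra_simps)
    then show ?thesis
      by (simp flip: sgn_mult)
  qed
  from ev have "\<forall>\<^sub>F p in F. (\<bar>f p\<bar> \<le> \<bar>g p\<bar>) = (s * r \<le> 0)"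
    by eventually_elim (simp add: eq)
  then show ?thesis
    by blast
qed

lemma sgn_stable_affine:
  assumes "filterlim X at_top F"
  shows "sgn_stable F (\<lambda>p. A + B * X p)"
proof -
  have pos: "sgn_stable F (\<lambda>p. A + B * X p)" if "B > 0" for A B
    using assms that
    by (intro sgn_stable_at_top filterlim_tendsto_add_at_top[OF tendsto_const]
        filterlim_tendsto_pos_mult_at_top[OF tendsto_const])
  consider "B > 0" | "B = 0" | "- B > 0"
    by linarith
  then show ?thesis
  proof cases
    case 3
    then show ?thesis
      using pos[of "- B" "- A"] by - (rule sgn_stable_uminus, simp add: algebra_simps)
  qed (auto simp: pos sgn_stable_const)
qed

text \<open>For positive \<open>D\<close> the nonconstant part is X (B + D Y), a product of two
  functions tending to infinity. Negative \<open>D\<close> follows by negation, and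
  \<open>D = 0\<close> is the affine case.\<close>

lemma sgn_stable_bilinear:
  assumes X: "filterlim X at_top F" and Y: "filterlim Y at_top F"
  shows "sgn_stable F (\<lambda>p. A + B * X p + D * (X p * Y p))"
proof -
  have pos: "sgn_stable F (\<lambda>p. A + B * X p + D * (X p * Y p))" if "D > 0" for A B D
  proof -
    have "filterlim (\<lambda>p. A + X p * (B + D * Y p)) at_top F"
      using that X Y
      by (intro filterlim_tendsto_add_at_top[OF tendsto_const] filterlim_at_top_mult_at_top
          filterlim_tendsto_pos_mult_at_top[OF tendsto_const])
    then show ?thesis
      by (intro sgn_stable_at_top) (simp add: algebra_simps)
  qed
  consider "D > 0" | "D = 0" | "- D > 0"
    by linarith
  then show ?thesis
  proof cases
    case 2
    then show ?thesis
      using sgn_stable_affine[OF X] by simp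
  next
    case 3
    then show ?thesis
      using pos[of "- D" "- A" "- B"] by - (rule sgn_stable_uminus, simp add: algebra_simps)
  qed (auto simp: pos)
qed

text \<open>The term that is linear in the other variable is deliberately absent: the sign of
  \<open>X - Y\<close> need not stabilise when both variables tend to infinity.\<close>

definition stable_pair :: "'p filter \<Rightarrow> ('p \<Rightarrow> real) \<Rightarrow> ('p \<Rightarrow> real) \<Rightarrow> bool" where
  "stable_pair F X Y \<longleftrightarrow>
    (\<forall>A B D. sgn_stable F (\<lambda>p. A + B * X p + D * (X p * Y p)) \<and>
             sgn_stable F (\<lambda>p. A + B * Y p + D * (X p * Y p)))"

lemma stable_pair_commute: "stable_pair F X Y \<Longrightarrow> stable_pair F Y X"
  unfolding stable_pair_def mult.commute[of "Y _" "X _"] by blast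

lemma stable_pair_at_top:
  assumes "filterlim X at_top F" "filterlim Y at_top F"
  shows "stable_pair F X Y"
  using sgn_stable_bilinear[OF assms] sgn_stable_bilinear[OF assms(2,1)]
  unfolding stable_pair_def mult.commute[of "Y _" "X _"] by blast

text \<open>With the second variable frozen, both required expressions are affine in the
  first.\<close>

lemma stable_pair_at_top_const:
  assumes "filterlim X at_top F"
  shows "stable_pair F X (\<lambda>p. y)"
  unfolding stable_pair_def
proof (intro allI conjI)
  fix A B D
  show "sgn_stable F (\<lambda>p. A + B * X p + D * (X p * y))"
    using sgn_stable_affine[OF assms, of A "B + D * y"] by (simp add: algebra_simps)
  show "sgn_stable F (\<lambda>p. A + B * y + D * (X p * y))"
    using sgn_stable_affine[OF assms, of "A + B * y" "D * y"] by (simp add: algebra_simps)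
qed

section \<open>Size restrictions on relative minima of a rank-1 lattice\<close>

lemma mem_rank1_lattice_iff:
  "x \<in> rank1_lattice a b N \<longleftrightarrow>
    (\<exists>m k l. x = vector [of_int m, of_int (a * m + N * k), of_int (b * m + N * l)])"
proof -
  have eq: "of_int m *\<^sub>R vector [1, of_int a, of_int b] + of_int k *\<^sub>R vector [0, of_int N, 0]
      + of_int l *\<^sub>R vector [0, 0, of_int N]
    = (vector [of_int m, of_int (a * m + N * k), of_int (b * m + N * l)] :: real^3)" for m k l
    unfolding vec_eq_iff forall_3 vector_add_component vector_scaleR_component vector_3
      of_int_add of_int_mult real_scaleR_def
    by (simp add: mult.commute)
  show ?thesis
    unfolding rank1_lattice_def mem_Collect_eq eq by simp
qed

lemma vrm_abs_set_minimal:
  assumes "cabs x \<in> vrm (abs_set \<Gamma>)" "z \<in> \<Gamma>" "z \<noteq> 0" "\<And>i. \<bar>z $ i\<bar> \<le> \<bar>x $ i\<bar>"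
  shows "\<bar>z $ i\<bar> = \<bar>x $ i\<bar>"
proof -
  have "cabs z \<in> abs_set \<Gamma>"
    using assms by (auto simp: abs_set_eq)
  then have "cabs z = cabs x"
    using assms abs_set_nonneg mem_vrm_iff[of "abs_set \<Gamma>" "cabs x"] by auto
  then show ?thesis
    by (metis cabs_nth)
qed

text \<open>The integer form allows explicit lattice vectors to be substituted. In each use some
  coordinate of the vector is strictly smaller in absolute value, which contradicts the equality
  obtained.\<close>

lemma vrm_rank1_lattice_minimal:
  assumes "cabs (vector [of_int x1, of_int x2, of_int x3]) \<in> vrm (abs_set (rank1_lattice a b N))"
    and "\<bar>m\<bar> \<le> \<bar>x1\<bar>" "\<bar>a * m + N * k\<bar> \<le> \<bar>x2\<bar>" "\<bar>b * m + N * l\<bar> \<le> \<bar>x3\<bar>"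
    and "m \<noteq> 0 \<or> a * m + N * k \<noteq> 0 \<or> b * m + N * l \<noteq> 0"
  shows "\<bar>m\<bar> = \<bar>x1\<bar> \<and> \<bar>a * m + N * k\<bar> = \<bar>x2\<bar> \<and> \<bar>b * m + N * l\<bar> = \<bar>x3\<bar>"
proof -
  let ?z = "vector [of_int m, of_int (a * m + N * k), of_int (b * m + N * l)] :: real^3"
  let ?x = "vector [of_int x1, of_int x2, of_int x3] :: real^3"
  have z: "?z \<in> rank1_lattice a b N"
    unfolding mem_rank1_lattice_iff by blast
  have nz: "?z \<noteq> 0"
    using assms(5) unfolding vec_eq_iff forall_3 vector_3 zero_index of_int_eq_0_iff by blast
  have "\<forall>i. \<bar>?z $ i\<bar> \<le> \<bar>?x $ i\<bar>"
    using assms(2-4) unfolding forall_3 vector_3 of_int_abs[symmetric] of_int_le_iff by blast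
  then have "\<forall>i. \<bar>?z $ i\<bar> = \<bar>?x $ i\<bar>"
    using vrm_abs_set_minimal[OF assms(1) z nz] by blast
  then show ?thesis
    unfolding forall_3 vector_3 of_int_abs[symmetric] of_int_eq_iff .
qed

lemma vrm_rank1_lattice_le:
  assumes "0 < N"
    and v: "cabs (vector [of_int x1, of_int x2, of_int x3]) \<in> vrm (abs_set (rank1_lattice a b N))"
  shows "\<bar>x1\<bar> \<le> N \<and> \<bar>x2\<bar> \<le> N \<and> \<bar>x3\<bar> \<le> N"
proof -
  note min = vrm_rank1_lattice_minimal[OF v]
  \<comment> \<open>The coefficients \<open>N\<close>, \<open>- a\<close>, \<open>- b\<close>
    produce \<open>N\<close> times the first unit vector; the other two multiples are
    generators.\<close>
  have eq: "a * N + N * - a = 0" "b * N + N * - b = 0"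
    by simp_all
  have "\<bar>x1\<bar> \<le> N"
    using min[of N "- a" "- b", unfolded eq] assms(1) by (cases "\<bar>x1\<bar> \<le> N") simp_all
  moreover have "\<bar>x2\<bar> \<le> N"
    using min[of 0 1 0] assms(1) by (cases "\<bar>x2\<bar> \<le> N") simp_all
  moreover have "\<bar>x3\<bar> \<le> N"
    using min[of 0 0 1] assms(1) by (cases "\<bar>x3\<bar> \<le> N") simp_all
  ultimately show ?thesis
    by blast
qed

text \<open>Comparison with (1, a, b) bounds the second or third coordinate, comparison with (c, a
  c, -\<alpha>) bounds one of the three; distributing the two disjunctions gives the
  alternatives.\<close>

lemma vrm_rank1_lattice_cases:
  fixes a b c \<alpha> :: int
  assumes "1 \<le> a" "1 \<le> \<alpha>" "\<alpha> \<le> b" "1 \<le> c" and N: "N = b * c + \<alpha>"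
    and x: "x2 = a * x1 + N * k" "x3 = b * x1 + N * l"
    and v: "cabs (vector [of_int x1, of_int x2, of_int x3]) \<in> vrm (abs_set (rank1_lattice a b N))"
  shows "\<bar>x3\<bar> \<le> \<alpha> \<or> \<bar>x2\<bar> \<le> a \<or>
    \<bar>x3\<bar> \<le> b \<and> (\<bar>x2\<bar> \<le> a * c \<or> \<bar>x1\<bar> \<le> c)"
proof -
  have "0 < N"
    using assms by (simp add: add_nonneg_pos)
  note min = vrm_rank1_lattice_minimal[OF v]
  show ?thesis
  proof (cases "x1 = 0")
    \<comment> \<open>Here (1, a, b) cannot be used, its first coordinate being too large. Both
      other coordinates are multiples of \<open>N\<close>; were both nonzero, (0, N, 0) would be
      dominated, strictly in the third coordinate.\<close>
    case True
    have "x2 = 0 \<or> x3 = 0"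
    proof (rule ccontr)
      assume *: "\<not> (x2 = 0 \<or> x3 = 0)"
      then have "k \<noteq> 0"
        using x True by auto
      then have "N * 1 \<le> N * \<bar>k\<bar>"
        using \<open>0 < N\<close> by (intro mult_left_mono) auto
      then have "\<bar>N\<bar> \<le> \<bar>x2\<bar>"
        using x True \<open>0 < N\<close> by (simp add: abs_mult)
      then show False
        using min[of 0 1 0] * \<open>0 < N\<close> by auto
    qed
    then show ?thesis
      using assms by auto
  next
    case False
    have "\<bar>x2\<bar> \<le> a \<or> \<bar>x3\<bar> \<le> b"
    proof (rule ccontr)
      assume "\<not> ?thesis"
      moreover have "1 \<le> \<bar>x1\<bar>"
        using False by linarith
      ultimately show False
        using min[of 1 0 0] assms(1-3) by simp
    qed
    moreover have "\<bar>x1\<bar> \<le> c \<or> \<bar>x2\<bar> \<le> a * c \<or> \<bar>x3\<bar> \<le> \<alpha>"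
    proof (rule ccontr)
      assume *: "\<not> ?thesis"
      \<comment> \<open>The vector is \<open>c\<close> times (1, a, b) minus the third
        generator.\<close>
      have eq: "b * c + N * - 1 = - \<alpha>"
        by (simp add: N)
      have "0 \<le> a * c"
        using assms(1,4) by simp
      then show False
        using min[of c 0 "- 1", unfolded eq] * assms(1-4) by simp
    qed
    ultimately show ?thesis
      by blast
  qed
qed

section \<open>A finite family of candidates, uniform in the parameters\<close>

locale lattice_family =
  fixes a \<alpha> \<beta> \<gamma> :: int
  assumes a: "1 \<le> a" and \<alpha>: "1 \<le> \<alpha>" and \<beta>: "0 \<le> \<beta>" and \<gamma>: "0 \<le> \<gamma>"
begin

definition B :: "nat \<Rightarrow> int" where "B t = \<alpha> * a * int t + \<beta>"
definition C :: "nat \<Rightarrow> int" where "C u = a * int u + \<gamma>"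
definition M :: "nat \<Rightarrow> nat \<Rightarrow> int" where "M t u = B t * C u + \<alpha>"

text \<open>
  A lattice point \<open>x = (m, a m + N k, b m + N l)\<close> is encoded by \<open>k\<close>, \<open>P = a (m + c l) + \<alpha> k\<close>
  and \<open>q = a l - b k\<close>; then \<open>x\<^sub>2 = P - c q\<close>, \<open>a x\<^sub>3 = b P + \<alpha> q\<close> and
  \<open>a x\<^sub>1 = x\<^sub>2 - N k\<close>. For relative minima \<open>P = P0 + P1 c\<close> and \<open>q = q0 + q1 t\<close> with
  coefficients bounded by \<open>K\<close>; the divisibility conditions say that \<open>m\<close> and \<open>l\<close> are integers.
\<close>

definition K :: int where "K = 4 * (a * a * \<alpha>) + 4 * (a * a * \<alpha>) * \<beta>"

definition indices :: "(int \<times> int \<times> int \<times> int \<times> int) set" where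
  "indices = {(k, P0, P1, q0, q1).
     \<bar>k\<bar> \<le> K \<and> \<bar>P0\<bar> \<le> K \<and> \<bar>P1\<bar> \<le> K \<and> \<bar>q0\<bar> \<le> K \<and> \<bar>q1\<bar> \<le> K \<and>
     a dvd q1 \<and> a dvd q0 + \<beta> * k \<and> a dvd P0 + P1 * \<gamma> - \<alpha> * k}"

definition cand :: "nat \<times> nat \<Rightarrow> int \<times> int \<times> int \<times> int \<times> int \<Rightarrow> real^3" where
  "cand = (\<lambda>(t, u) (k, P0, P1, q0, q1).
     let P = P0 + P1 * C u; q = q0 + q1 * int t
     in vector [of_int (P - C u * q - M t u * k) / of_int a, of_int (P - C u * q),
                of_int (B t * P + \<alpha> * q) / of_int a])"

lemma finite_indices: "finite indices"
  by (rule finite_subset[of _ "{-K..K} \<times> {-K..K} \<times> {-K..K} \<times> {-K..K} \<times> {-K..K}"])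
    (auto simp: indices_def)

text \<open>Decoding inverts the encoding: both numerators become multiples of \<open>a\<close>, so
  the real divisions in \<open>cand\<close> are exact.\<close>

lemma cand_eq:
  assumes "P0 + P1 * C u = a * (m + C u * l) + \<alpha> * k" "q0 + q1 * int t = a * l - B t * k"
  shows "cand (t, u) (k, P0, P1, q0, q1) =
    vector [of_int m, of_int (a * m + M t u * k), of_int (B t * m + M t u * l)]"
proof -
  have x1: "P0 + P1 * C u - C u * (q0 + q1 * int t) - M t u * k = a * m"
    and x2: "P0 + P1 * C u - C u * (q0 + q1 * int t) = a * m + M t u * k"
    and x3: "B t * (P0 + P1 * C u) + \<alpha> * (q0 + q1 * int t) = a * (B t * m + M t u * l)"
    unfolding assms M_def by (simp_all add: algebra_simps)
  show ?thesis
    unfolding cand_def Let_def split x1 x3 unfolding x2 using a by simp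
qed

lemma cand_mem:
  assumes "j \<in> indices"
  shows "cand (t, u) j \<in> rank1_lattice a (B t) (M t u)"
proof -
  obtain k P0 P1 q0 q1 where j: "j = (k, P0, P1, q0, q1)"
    by (metis prod_cases5)
  obtain x y z where dvd: "q1 = a * x" "q0 + \<beta> * k = a * y" "P0 + P1 * \<gamma> - \<alpha> * k = a * z"
    using assms by (auto simp: indices_def j dvd_def)
  \<comment> \<open>\<open>l\<close> and then \<open>m\<close> solve the encoding equations for q
    and P, using \<open>B t\<close> = \<alpha> a t + \<beta> and \<open>C u\<close> = a u +
    \<gamma>; the terms not visibly divisible by \<open>a\<close> are those in the divisibility
    conditions.\<close>
  define l where "l = y + x * int t + \<alpha> * int t * k"
  define m where "m = z + P1 * int u - C u * l"
  have "P0 = a * z - P1 * \<gamma> + \<alpha> * k" "q0 = a * y - \<beta> * k"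
    using dvd by auto
  then have "P0 + P1 * C u = a * (m + C u * l) + \<alpha> * k" "q0 + q1 * int t = a * l - B t * k"
    unfolding m_def l_def B_def C_def dvd(1) by (simp_all add: algebra_simps)
  then show ?thesis
    unfolding j mem_rank1_lattice_iff using cand_eq by blast
qed

text \<open>A candidate vanishes iff its absolute values are at most those of this one, so vanishing
  too is decided by comparisons of candidates.\<close>

lemma zero_index: "(0, 0, 0, 0, 0) \<in> indices" "cand p (0, 0, 0, 0, 0) = 0"
proof -
  have "0 \<le> K"
    using a \<alpha> \<beta> by (simp add: K_def)
  then show "(0, 0, 0, 0, 0) \<in> indices"
    by (simp add: indices_def)
  show "cand p (0, 0, 0, 0, 0) = 0"
    by (cases p) (simp add: cand_eq[of 0 0 _ 0 0 0 0 0] vec_eq_iff forall_3)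
qed

text \<open>These are the coefficient sizes arising in the cases of
  \<open>indices_cover\<close>.\<close>

lemma K_bounds:
  "1 + a \<le> K" "\<alpha> + a \<le> K" "a * \<alpha> + \<beta> * (\<alpha> + a) \<le> K" "a * (\<alpha> + a) \<le> K" "2 * a \<le> K"
  "2 * a + \<beta> * (1 + a) \<le> K" "\<alpha> * a * (1 + a) \<le> K" "2 * a + \<alpha> * (1 + a) \<le> K"
proof -
  define W where "W = a * a * \<alpha>"
  have mono: "x \<le> x * y" if "1 \<le> x" "1 \<le> y" for x y :: int
    using that mult_left_mono[of 1 y x] by simp
  have aa: "1 \<le> a * a" "a \<le> a * a" "1 \<le> a * \<alpha>" "a \<le> a * \<alpha>" "\<alpha> \<le> \<alpha> * a"
    using mono[OF a a] mono[OF a \<alpha>] mono[OF \<alpha> a] a \<alpha> by linarith+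
  have W: "a * a \<le> W" "a * \<alpha> \<le> W"
    using mono[OF aa(1) \<alpha>] mono[OF aa(3) a] by (auto simp: W_def mult_ac)
  have le: "1 \<le> W" "a \<le> W" "\<alpha> \<le> W"
    using W aa a mult.commute[of a \<alpha>] by linarith+
  have le\<beta>: "\<beta> \<le> W * \<beta>" "\<beta> * a \<le> W * \<beta>" "\<beta> * \<alpha> \<le> W * \<beta>"
    using mult_right_mono[OF le(1) \<beta>] mult_right_mono[OF le(2) \<beta>] mult_right_mono[OF le(3) \<beta>]
    by (simp_all add: mult.commute)
  have K: "K = 4 * W + 4 * (W * \<beta>)" "\<alpha> * (a * a) = W" "\<alpha> * a = a * \<alpha>"
    by (simp_all add: K_def W_def mult_ac)
  have "0 \<le> W * \<beta>"
    using le \<beta> by simp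
  then show "1 + a \<le> K" "\<alpha> + a \<le> K" "a * \<alpha> + \<beta> * (\<alpha> + a) \<le> K" "a * (\<alpha> + a) \<le> K" "2 * a \<le> K"
    "2 * a + \<beta> * (1 + a) \<le> K" "\<alpha> * a * (1 + a) \<le> K" "2 * a + \<alpha> * (1 + a) \<le> K"
    using K W le le\<beta> unfolding distrib_left mult_1_right mult.assoc by linarith+
qed

lemma indices_cover:
  assumes b: "\<alpha> \<le> B t" and c: "1 \<le> C u"
    and x: "x2 = a * x1 + M t u * k" "x3 = B t * x1 + M t u * l"
    and le: "\<bar>x1\<bar> \<le> M t u" "\<bar>x2\<bar> \<le> M t u" "\<bar>x3\<bar> \<le> M t u"
    and cases: "\<bar>x3\<bar> \<le> \<alpha> \<or> \<bar>x2\<bar> \<le> a \<or>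
      \<bar>x3\<bar> \<le> B t \<and> (\<bar>x2\<bar> \<le> a * C u \<or> \<bar>x1\<bar> \<le> C u)"
  shows "\<exists>P0 P1 q0 q1. (k, P0, P1, q0, q1) \<in> indices \<and>
    P0 + P1 * C u = a * (x1 + C u * l) + \<alpha> * k \<and> q0 + q1 * int t = a * l - B t * k"
proof -
  define b c N where "b = B t" and "c = C u" and "N = M t u"
  define P q where "P = a * (x1 + c * l) + \<alpha> * k" and "q = a * l - b * k"
  have b1: "1 \<le> b" and c1: "1 \<le> c" and b\<alpha>: "\<alpha> \<le> b"
    using b c \<alpha> by (auto simp: b_def c_def)
  have N: "N = b * c + \<alpha>"
    by (simp add: N_def b_def c_def M_def)
  have bt: "b = \<alpha> * a * int t + \<beta>" and cu: "c = a * int u + \<gamma>"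
    by (simp_all add: b_def c_def B_def C_def)
  have bcN: "b * c \<le> N" and "0 < N"
    using \<alpha> b1 c1 by (auto simp: N add_nonneg_pos)
  have "b * 1 \<le> b * c"
    using b1 c1 by (intro mult_left_mono) auto
  then have bN: "b \<le> N"
    using bcN by linarith
  have "\<alpha> * c \<le> b * c"
    using b\<alpha> c1 by (intro mult_right_mono) auto
  then have \<alpha>cN: "\<alpha> * c \<le> N"
    using bcN by linarith
  have a0: "0 \<le> a" using a by simp
  have NaN: "a * (b * c) \<le> a * N" "a * b \<le> a * N" "a * (\<alpha> * c) \<le> a * N"
    using mult_left_mono[OF bcN a0] mult_left_mono[OF bN a0] mult_left_mono[OF \<alpha>cN a0] by auto
  have pabs: "\<bar>p * y\<bar> \<le> p * z" if "0 \<le> p" "\<bar>y\<bar> \<le> z" for p y z :: int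
    using that by (simp add: abs_mult mult_left_mono)
  have cancel: "\<bar>y\<bar> \<le> z" if "\<bar>N * y\<bar> \<le> N * z" for y z
    using that \<open>0 < N\<close> by (simp add: abs_mult)
  note le = le[folded N_def] and cases = cases[folded b_def c_def]
  have x2: "x2 = a * x1 + N * k" and x3: "x3 = b * x1 + N * l"
    using x by (simp_all add: b_def N_def)
  have k: "\<bar>k\<bar> \<le> 1 + a"
  proof (rule cancel)
    have "N * k = x2 - a * x1"
      by (simp add: x2)
    then show "\<bar>N * k\<bar> \<le> N * (1 + a)"
      using le(2) pabs[OF a0 le(1)] by (simp add: algebra_simps; linarith?)
  qed
  \<comment> \<open>Bounds on the coordinates turn into bounds on \<open>P\<close> and
    \<open>q\<close> after division by \<open>N\<close>, which is at least \<open>b * c\<close>,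
    \<open>b\<close> and \<open>\<alpha> * c\<close>.\<close>
  have NP: "N * P = \<alpha> * x2 + c * a * x3" and Nq: "N * q = a * x3 - b * x2"
    and ax3: "a * x3 = b * P + \<alpha> * q" and x2': "x2 = P - c * q"
    by (simp_all add: x2 x3 P_def q_def N algebra_simps)
  have P: "a dvd P - \<alpha> * k"
    by (simp add: P_def)
  have "q + \<beta> * k = a * (l - \<alpha> * int t * k)"
    by (simp add: q_def bt algebra_simps)
  then have q: "a dvd q + \<beta> * k"
    by (metis dvd_triv_left)
  have ca0: "0 \<le> c * a" and \<alpha>0: "0 \<le> \<alpha>" and b0: "0 \<le> b"
    using a c1 \<alpha> b1 by auto
  note K = K_bounds
  have "\<exists>P0 P1 q0 q1. (k, P0, P1, q0, q1) \<in> indices \<and> P0 + P1 * c = P \<and> q0 + q1 * int t = q"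
    using cases
  proof (elim disjE conjE)
    assume A: "\<bar>x3\<bar> \<le> \<alpha>"
    have P_le: "\<bar>P\<bar> \<le> \<alpha> + a"
    proof (rule cancel)
      show "\<bar>N * P\<bar> \<le> N * (\<alpha> + a)"
        unfolding NP using pabs[OF \<alpha>0 le(2)] pabs[OF ca0 A] NaN by (simp add: algebra_simps; linarith?)
    qed
    \<comment> \<open>\<open>P\<close> is bounded but \<open>q\<close> may grow with
      \<open>t\<close>. Substituting b = \<alpha> a t + \<beta> into \<open>ax3\<close> isolates the
      growth as -a P t and leaves the bounded remainder \<open>q'\<close>.\<close>
    define q' where "q' = q + a * int t * P"
    have "\<alpha> * q' = a * x3 - \<beta> * P"
      by (simp add: ax3 q'_def bt algebra_simps)
    then have "\<bar>\<alpha> * q'\<bar> \<le> a * \<alpha> + \<beta> * (\<alpha> + a)"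
      using pabs[OF a0 A] pabs[OF \<beta> P_le] by linarith
    moreover have "\<bar>q'\<bar> \<le> \<bar>\<alpha> * q'\<bar>"
      using mult_right_mono[OF \<alpha>, of "\<bar>q'\<bar>"] \<alpha> by (simp add: abs_mult)
    ultimately have "\<bar>q'\<bar> \<le> K"
      using K by linarith
    moreover have "\<bar>- (a * P)\<bar> \<le> K"
      using pabs[OF a0 P_le] K by simp
    moreover have "q' + \<beta> * k = (q + \<beta> * k) + a * (int t * P)"
      by (simp add: q'_def)
    then have "a dvd q' + \<beta> * k"
      using q by (metis dvd_add dvd_triv_left)
    ultimately have "(k, P, 0, q', - (a * P)) \<in> indices"
      using P k P_le K by (simp add: indices_def)
    then show ?thesis
      by (intro exI[of _ P] exI[of _ 0] exI[of _ q'] exI[of _ "- (a * P)"])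
        (simp add: q'_def algebra_simps)
  next
    \<comment> \<open>Now \<open>q\<close> is bounded, and \<open>P = x2 + c * q\<close> supplies
      the coefficients \<open>x2\<close> and \<open>q\<close>.\<close>
    assume A: "\<bar>x2\<bar> \<le> a"
    have q_le: "\<bar>q\<bar> \<le> 2 * a"
    proof (rule cancel)
      show "\<bar>N * q\<bar> \<le> N * (2 * a)"
        unfolding Nq using pabs[OF a0 le(3)] pabs[OF b0 A] NaN by (simp add: algebra_simps; linarith?)
    qed
    have "x2 + q * \<gamma> - \<alpha> * k = (P - \<alpha> * k) - a * (int u * q)"
      by (simp add: x2' cu algebra_simps)
    then have "a dvd x2 + q * \<gamma> - \<alpha> * k"
      using P by (metis dvd_diff dvd_triv_left)
    then have "(k, x2, q, q, 0) \<in> indices"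
      using q q_le k A K by (simp add: indices_def)
    then show ?thesis
      by (intro exI[of _ x2] exI[of _ q] exI[of _ q] exI[of _ 0]) (simp add: x2')
  next
    assume A: "\<bar>x3\<bar> \<le> b" "\<bar>x2\<bar> \<le> a * c"
    have P_le: "\<bar>P\<bar> \<le> 2 * a"
    proof (rule cancel)
      show "\<bar>N * P\<bar> \<le> N * (2 * a)"
        unfolding NP using pabs[OF \<alpha>0 A(2)] pabs[OF ca0 A(1)] NaN by (simp add: algebra_simps; linarith?)
    qed
    have q_le: "\<bar>q\<bar> \<le> 2 * a"
    proof (rule cancel)
      show "\<bar>N * q\<bar> \<le> N * (2 * a)"
        unfolding Nq using pabs[OF a0 A(1)] pabs[OF b0 A(2)] NaN by (simp add: algebra_simps; linarith?)
    qed
    have "(k, P, 0, q, 0) \<in> indices"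
      using P q P_le q_le k K by (simp add: indices_def)
    then show ?thesis
      by (intro exI[of _ P] exI[of _ 0] exI[of _ q] exI[of _ 0]) simp
  next
    \<comment> \<open>Here \<open>a * l\<close> and \<open>k\<close> are bounded, and q = a l - b k
      is split by expanding \<open>b\<close> in \<open>t\<close>.\<close>
    assume A: "\<bar>x3\<bar> \<le> b" "\<bar>x1\<bar> \<le> c"
    have ab0: "0 \<le> a * b" and a\<alpha>0: "0 \<le> a * \<alpha>"
      using a0 b0 \<alpha>0 by auto
    have P_le: "\<bar>P - \<alpha> * k\<bar> \<le> 2 * a"
    proof (rule cancel)
      have "N * (P - \<alpha> * k) = a * \<alpha> * x1 + c * a * x3"
        unfolding right_diff_distrib NP by (simp add: x2 algebra_simps)
      then show "\<bar>N * (P - \<alpha> * k)\<bar> \<le> N * (2 * a)"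
        using pabs[OF a\<alpha>0 A(2)] pabs[OF ca0 A(1)] NaN by (simp add: algebra_simps; linarith?)
    qed
    have l_le: "\<bar>a * l\<bar> \<le> 2 * a"
    proof (rule cancel)
      have "N * (a * l) = a * x3 - a * b * x1"
        by (simp add: x3 algebra_simps)
      then show "\<bar>N * (a * l)\<bar> \<le> N * (2 * a)"
        using pabs[OF a0 A(1)] pabs[OF ab0 A(2)] NaN by (simp add: algebra_simps; linarith?)
    qed
    have "\<bar>P\<bar> \<le> K"
      using P_le pabs[OF \<alpha>0 k] K by linarith
    moreover have "\<bar>a * l - \<beta> * k\<bar> \<le> K"
      using l_le pabs[OF \<beta> k] K by linarith
    moreover have "\<bar>- (\<alpha> * a * k)\<bar> \<le> K"
      using pabs[of "\<alpha> * a", OF _ k] a0 \<alpha>0 K by simp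
    ultimately have "(k, P, 0, a * l - \<beta> * k, - (\<alpha> * a * k)) \<in> indices"
      using P k K by (simp add: indices_def)
    then show ?thesis
      by (intro exI[of _ P] exI[of _ 0] exI[of _ "a * l - \<beta> * k"] exI[of _ "- (\<alpha> * a * k)"])
        (simp add: q_def bt algebra_simps)
  qed
  then show ?thesis
    by (simp add: P_def q_def b_def c_def)
qed

text \<open>The nonzero candidates lie between the relative minima and the whole set of absolute
  values, so \<open>vrm_eq_between\<close> applies.\<close>

lemma vrm_eq_vrm_cand:
  assumes b: "\<alpha> \<le> B t" and c: "1 \<le> C u"
  shows "vrm (cabs ` cand (t, u) ` indices - {0}) = vrm (abs_set (rank1_lattice a (B t) (M t u)))"
proof (rule vrm_eq_between)
  let ?\<Gamma> = "rank1_lattice a (B t) (M t u)"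
  show "0 \<le> x $ i" if "x \<in> abs_set ?\<Gamma>" for x i
    using that by (rule abs_set_nonneg)
  show "x $ i \<in> \<int>" if xS: "x \<in> abs_set ?\<Gamma>" for x i
  proof -
    obtain m k l where x: "x = cabs (vector [of_int m, of_int (a * m + M t u * k), of_int (B t * m + M t u * l)])"
      using xS unfolding abs_set_eq Diff_iff image_iff Bex_def mem_rank1_lattice_iff by blast
    have "\<forall>i. x $ i \<in> \<int>"
      unfolding forall_3 x cabs_nth vector_3 by (intro conjI Ints_abs Ints_of_int)
    then show ?thesis
      by simp
  qed
  show "cabs ` cand (t, u) ` indices - {0} \<subseteq> abs_set ?\<Gamma>"
    using cand_mem unfolding abs_set_eq by blast
  show "vrm (abs_set ?\<Gamma>) \<subseteq> cabs ` cand (t, u) ` indices - {0}"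
  proof
    fix v assume v: "v \<in> vrm (abs_set ?\<Gamma>)"
    then have "v \<in> abs_set ?\<Gamma>"
      using vrm_subset by blast
    then obtain x1 k l where x: "v \<noteq> 0"
      "v = cabs (vector [of_int x1, of_int (a * x1 + M t u * k), of_int (B t * x1 + M t u * l)])"
      unfolding abs_set_eq Diff_iff image_iff Bex_def mem_rank1_lattice_iff by blast
    have "0 < M t u"
      unfolding M_def using b c \<alpha> by (simp add: add_nonneg_pos)
    note vx = v[unfolded x]
    obtain P0 P1 q0 q1 where j: "(k, P0, P1, q0, q1) \<in> indices"
      "P0 + P1 * C u = a * (x1 + C u * l) + \<alpha> * k" "q0 + q1 * int t = a * l - B t * k"
      using indices_cover[OF b c refl refl _ _ _ vrm_rank1_lattice_cases[OF a \<alpha> b c M_def refl refl vx]]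
        vrm_rank1_lattice_le[OF \<open>0 < M t u\<close> vx] by blast
    have "v = cabs (cand (t, u) (k, P0, P1, q0, q1))"
      unfolding cand_eq[OF j(2,3)] by (rule x)
    then show "v \<in> cabs ` cand (t, u) ` indices - {0}"
      using j(1) x(1) by blast
  qed
qed

section \<open>Eventual constancy of the comparisons between candidates\<close>

lemma cand_coeffs:
  obtains A1 B1 D1 A2 B2 D2 A3 B3 D3 :: real
  where "\<And>t u. cand (t, u) j $ 1 = A1 + B1 * of_int (C u) + D1 * (of_int (B t) * of_int (C u))"
    and "\<And>t u. cand (t, u) j $ 2 = A2 + B2 * of_int (C u) + D2 * (of_int (B t) * of_int (C u))"
    and "\<And>t u. cand (t, u) j $ 3 = A3 + B3 * of_int (B t) + D3 * (of_int (B t) * of_int (C u))"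
proof -
  obtain k P0 P1 q0 q1 where j: "j = (k, P0, P1, q0, q1)"
    by (metis prod_cases5)
  \<comment> \<open>\<open>r\<close> comes from rewriting t as (B t - \<beta>) / (\<alpha> a). In
    coordinates 1 and 2 the parameter t occurs only multiplied by \<open>C u\<close>, so no term
    linear in \<open>B t\<close> appears; coordinate 3 has none linear in \<open>C u\<close>. This
    is the shape \<open>stable_pair\<close> admits.\<close>
  define r where "r = real_of_int q1 / (of_int \<alpha> * of_int a)"
  have pos: "real_of_int a \<noteq> 0" "real_of_int \<alpha> \<noteq> 0"
    using a \<alpha> by auto
  have q1: "real_of_int q1 * real t = r * of_int (B t) - r * of_int \<beta>" for t
    using pos by (simp add: r_def B_def field_simps)
  show thesis
  proof (rule that)
    fix t u
    have x2: "cand (t, u) j $ 2 = of_int P0 + of_int P1 * of_int (C u)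
        - of_int (C u) * (of_int q0 + real_of_int q1 * real t)"
      by (simp add: cand_def j Let_def)
    then show x2': "cand (t, u) j $ 2 = of_int P0 + (of_int P1 - of_int q0 + r * of_int \<beta>) * of_int (C u)
        + (- r) * (of_int (B t) * of_int (C u))"
      unfolding q1 by (simp add: algebra_simps)
    have x1: "cand (t, u) j $ 1 =
        (cand (t, u) j $ 2 - (of_int (B t) * of_int (C u) + of_int \<alpha>) * of_int k) / of_int a"
      unfolding x2 by (simp add: cand_def j Let_def M_def)
    show "cand (t, u) j $ 1 = (of_int P0 - of_int \<alpha> * of_int k) / of_int a
        + (of_int P1 - of_int q0 + r * of_int \<beta>) / of_int a * of_int (C u)
        + (- r - of_int k) / of_int a * (of_int (B t) * of_int (C u))"
      unfolding x1 x2' by (simp add: add_divide_distrib diff_divide_distrib algebra_simps)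
    have x3: "cand (t, u) j $ 3 = (of_int (B t) * (of_int P0 + of_int P1 * of_int (C u))
        + of_int \<alpha> * (of_int q0 + real_of_int q1 * real t)) / of_int a"
      by (simp add: cand_def j Let_def)
    show "cand (t, u) j $ 3 = of_int \<alpha> * (of_int q0 - r * of_int \<beta>) / of_int a
        + (of_int P0 + of_int \<alpha> * r) / of_int a * of_int (B t)
        + of_int P1 / of_int a * (of_int (B t) * of_int (C u))"
      unfolding x3 q1 by (simp add: add_divide_distrib diff_divide_distrib algebra_simps)
  qed
qed

lemma cand_comparison_stable:
  assumes st: "stable_pair F (\<lambda>(t, u). real_of_int (B t)) (\<lambda>(t, u). real_of_int (C u))"
  shows "\<exists>s. \<forall>\<^sub>F p in F. (\<bar>cand p j $ i\<bar> \<le> \<bar>cand p j' $ i\<bar>) = s"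
proof -
  obtain A1 B1 D1 A2 B2 D2 A3 B3 D3
    where j: "\<And>t u. cand (t, u) j $ 1 = A1 + B1 * of_int (C u) + D1 * (of_int (B t) * of_int (C u))"
      "\<And>t u. cand (t, u) j $ 2 = A2 + B2 * of_int (C u) + D2 * (of_int (B t) * of_int (C u))"
      "\<And>t u. cand (t, u) j $ 3 = A3 + B3 * of_int (B t) + D3 * (of_int (B t) * of_int (C u))"
    using cand_coeffs[of j] by metis
  obtain A1' B1' D1' A2' B2' D2' A3' B3' D3'
    where j': "\<And>t u. cand (t, u) j' $ 1 = A1' + B1' * of_int (C u) + D1' * (of_int (B t) * of_int (C u))"
      "\<And>t u. cand (t, u) j' $ 2 = A2' + B2' * of_int (C u) + D2' * (of_int (B t) * of_int (C u))"
      "\<And>t u. cand (t, u) j' $ 3 = A3' + B3' * of_int (B t) + D3' * (of_int (B t) * of_int (C u))"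
    using cand_coeffs[of j'] by metis
  have sX: "sgn_stable F (\<lambda>(t, u). A + B' * of_int (B t) + D * (of_int (B t) * of_int (C u)))" for A B' D
    using st unfolding stable_pair_def by (simp add: case_prod_unfold)
  have sY: "sgn_stable F (\<lambda>(t, u). A + B' * of_int (C u) + D * (of_int (B t) * of_int (C u)))" for A B' D
    using st unfolding stable_pair_def by (simp add: case_prod_unfold)
  have minus: "(\<lambda>p. cand p j $ i - cand p j' $ i) = (\<lambda>(t, u). cand (t, u) j $ i - cand (t, u) j' $ i)"
    and plus: "(\<lambda>p. cand p j $ i + cand p j' $ i) = (\<lambda>(t, u). cand (t, u) j $ i + cand (t, u) j' $ i)" for i
    by auto
  have "\<forall>i. sgn_stable F (\<lambda>p. cand p j $ i - cand p j' $ i)"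
    unfolding forall_3 minus j j'
    using sY[of "A1 - A1'" "B1 - B1'" "D1 - D1'"] sY[of "A2 - A2'" "B2 - B2'" "D2 - D2'"]
      sX[of "A3 - A3'" "B3 - B3'" "D3 - D3'"] by (simp add: algebra_simps)
  moreover have "\<forall>i. sgn_stable F (\<lambda>p. cand p j $ i + cand p j' $ i)"
    unfolding forall_3 plus j j'
    using sY[of "A1 + A1'" "B1 + B1'" "D1 + D1'"] sY[of "A2 + A2'" "B2 + B2'" "D2 + D2'"]
      sX[of "A3 + A3'" "B3 + B3'" "D3 + D3'"] by (simp add: algebra_simps)
  ultimately show ?thesis
    by (intro abs_le_stable) auto
qed

text \<open>An arbitrary filter serves all three regimes. The comparisons are finite in number, so
  eventually all of them hold their final truth values simultaneously.\<close>

lemma eventually_equivalent: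
  assumes st: "stable_pair F (\<lambda>(t, u). real_of_int (B t)) (\<lambda>(t, u). real_of_int (C u))"
    and ev: "\<forall>\<^sub>F (t, u) in F. \<alpha> < B t \<and> 1 \<le> C u"
  obtains Q where "eventually Q F" "\<And>t u. Q (t, u) \<Longrightarrow> \<alpha> < B t"
    and "\<And>t u t' u'. Q (t, u) \<Longrightarrow> Q (t', u') \<Longrightarrow> combinatorially_equivalent
      (MV_lattice (rank1_lattice a (B t) (M t u))) (MV_lattice (rank1_lattice a (B t') (M t' u')))"
proof -
  have "\<forall>x. \<exists>s. \<forall>\<^sub>F p in F. (\<bar>cand p (fst x) $ snd (snd x)\<bar> \<le> \<bar>cand p (fst (snd x)) $ snd (snd x)\<bar>) = s"
    using cand_comparison_stable[OF st] by blast
  from choice[OF this] obtain s where "\<forall>x. \<forall>\<^sub>F p in F.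
      (\<bar>cand p (fst x) $ snd (snd x)\<bar> \<le> \<bar>cand p (fst (snd x)) $ snd (snd x)\<bar>) = s x"
    by (rule exE)
  then have "\<forall>\<^sub>F p in F. \<forall>x\<in>indices \<times> indices \<times> UNIV.
      (\<bar>cand p (fst x) $ snd (snd x)\<bar> \<le> \<bar>cand p (fst (snd x)) $ snd (snd x)\<bar>) = s x"
    by (intro eventually_ball_finite finite_cartesian_product finite_indices) auto
  then have s: "\<forall>\<^sub>F p in F. \<forall>j\<in>indices. \<forall>j'\<in>indices. \<forall>i.
      (\<bar>cand p j $ i\<bar> \<le> \<bar>cand p j' $ i\<bar>) = s (j, j', i)"
    by (rule eventually_mono) auto
  define Q where "Q = (\<lambda>(t, u). \<alpha> < B t \<and> 1 \<le> C u \<and> (\<forall>j\<in>indices. \<forall>j'\<in>indices. \<forall>i.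
      (\<bar>cand (t, u) j $ i\<bar> \<le> \<bar>cand (t, u) j' $ i\<bar>) = s (j, j', i)))"
  show thesis
  proof (rule that[of Q])
    show "eventually Q F"
      using ev s by eventually_elim (simp add: Q_def split_beta)
    show "\<alpha> < B t" if "Q (t, u)" for t u
      using that unfolding Q_def prod.case by blast
    fix t u t' u' assume Q: "Q (t, u)" "Q (t', u')"
    note Q' = Q[unfolded Q_def prod.case]
    have ord: "\<bar>cand (t, u) j $ i\<bar> \<le> \<bar>cand (t, u) j' $ i\<bar> \<longleftrightarrow>
        \<bar>cand (t', u') j $ i\<bar> \<le> \<bar>cand (t', u') j' $ i\<bar>" if "j \<in> indices" "j' \<in> indices" for j j' i
      using Q' that by metis
    have "cand (t, u) j = 0 \<longleftrightarrow> cand (t', u') j = 0" if "j \<in> indices" for j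
      using ord[OF that zero_index(1)] unfolding zero_index(2) vec_eq_iff by simp
    then have "combinatorially_equivalent (MV (vrm (cabs ` cand (t, u) ` indices - {0})))
        (MV (vrm (cabs ` cand (t', u') ` indices - {0})))"
      using ord by (intro MV_vrm_equivalent_of_indexed)
    then show "combinatorially_equivalent
        (MV_lattice (rank1_lattice a (B t) (M t u))) (MV_lattice (rank1_lattice a (B t') (M t' u')))"
      unfolding MV_lattice_def using Q' vrm_eq_vrm_cand by (metis order_less_imp_le)
  qed
qed

section \<open>The three stabilization regimes\<close>

lemma filterlim_B: "filterlim (\<lambda>t. real_of_int (B t)) at_top sequentially"
proof -
  have "filterlim (\<lambda>t. of_int \<beta> + of_int (\<alpha> * a) * real t) at_top sequentially"
    using a \<alpha> by (intro filterlim_tendsto_add_at_top[OF tendsto_const]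
        filterlim_tendsto_pos_mult_at_top[OF tendsto_const] filterlim_real_sequentially) auto
  then show ?thesis
    by (simp add: B_def algebra_simps)
qed

lemma filterlim_C: "filterlim (\<lambda>u. real_of_int (C u)) at_top sequentially"
proof -
  have "filterlim (\<lambda>u. of_int \<gamma> + of_int a * real u) at_top sequentially"
    using a by (intro filterlim_tendsto_add_at_top[OF tendsto_const]
        filterlim_tendsto_pos_mult_at_top[OF tendsto_const] filterlim_real_sequentially) auto
  then show ?thesis
    by (simp add: C_def algebra_simps)
qed

lemma eventually_B: "\<forall>\<^sub>F t in sequentially. \<alpha> < B t"
  using filterlim_B unfolding filterlim_at_top_dense
  by (auto dest!: spec[of _ "real_of_int \<alpha>"])

lemma eventually_C: "\<forall>\<^sub>F u in sequentially. 1 \<le> C u"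
  using filterlim_C unfolding filterlim_at_top
  by (auto dest!: spec[of _ "1 :: real"])

lemma tu_stabilization:
  "\<exists>t0 u0. \<alpha> < B t0 \<and> (\<forall>t u. t > t0 \<and> u > u0 \<longrightarrow> combinatorially_equivalent
     (MV_lattice (rank1_lattice a (B t) (M t u))) (MV_lattice (rank1_lattice a (B t0) (M t0 u0))))"
proof -
  let ?F = "sequentially \<times>\<^sub>F sequentially"
  have "stable_pair ?F (\<lambda>(t, u). real_of_int (B t)) (\<lambda>(t, u). real_of_int (C u))"
    unfolding case_prod_unfold
    by (intro stable_pair_at_top filterlim_compose[OF filterlim_B filterlim_fst]
        filterlim_compose[OF filterlim_C filterlim_snd])
  moreover have "\<forall>\<^sub>F (t, u) in ?F. \<alpha> < B t \<and> 1 \<le> C u"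
    unfolding case_prod_unfold
    using eventually_B eventually_C
    by (intro eventually_conj) (auto intro: eventually_compose_filterlim filterlim_fst filterlim_snd)
  ultimately obtain Q where Q: "eventually Q ?F" "\<And>t u. Q (t, u) \<Longrightarrow> \<alpha> < B t"
    "\<And>t u t' u'. Q (t, u) \<Longrightarrow> Q (t', u') \<Longrightarrow> combinatorially_equivalent
      (MV_lattice (rank1_lattice a (B t) (M t u))) (MV_lattice (rank1_lattice a (B t') (M t' u')))"
    by (rule eventually_equivalent) (rule that)
  \<comment> \<open>One threshold serves both parameters. The bound names are swapped: the first
    component of the pair is the parameter of \<open>B\<close>.\<close>
  obtain n where "\<forall>t\<ge>n. \<forall>u\<ge>n. Q (u, t)"
    using Q(1) unfolding eventually_prod_sequentially by blast
  then show ?thesis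
    using Q(2,3) by (intro exI[of _ n]) auto
qed

lemma t_stabilization:
  "\<exists>t0. \<alpha> < B t0 \<and> (\<forall>t>t0. combinatorially_equivalent
     (MV_lattice (rank1_lattice a (B t) (M t u))) (MV_lattice (rank1_lattice a (B t0) (M t0 u))))"
proof (cases "1 \<le> C u")
  case True
  \<comment> \<open>Pairs with \<open>u\<close> fixed and \<open>t\<close> tending to
    infinity.\<close>
  let ?F = "filtermap (\<lambda>t. (t, u)) sequentially"
  have "filterlim (\<lambda>(t, u). real_of_int (B t)) at_top ?F"
    using filterlim_B by (simp add: filterlim_filtermap)
  then have "stable_pair ?F (\<lambda>(t, u). real_of_int (B t)) (\<lambda>p. real_of_int (C u))"
    by (rule stable_pair_at_top_const)
  then have "stable_pair ?F (\<lambda>(t, u). real_of_int (B t)) (\<lambda>(t, u). real_of_int (C u))"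
    by (simp add: stable_pair_def sgn_stable_def eventually_filtermap)
  moreover have "\<forall>\<^sub>F (t, u) in ?F. \<alpha> < B t \<and> 1 \<le> C u"
    using eventually_B True by (simp add: eventually_filtermap)
  ultimately obtain Q where Q: "eventually Q ?F" "\<And>t u. Q (t, u) \<Longrightarrow> \<alpha> < B t"
    "\<And>t u t' u'. Q (t, u) \<Longrightarrow> Q (t', u') \<Longrightarrow> combinatorially_equivalent
      (MV_lattice (rank1_lattice a (B t) (M t u))) (MV_lattice (rank1_lattice a (B t') (M t' u')))"
    by (rule eventually_equivalent) (rule that)
  obtain n where "\<forall>t\<ge>n. Q (t, u)"
    using Q(1) unfolding eventually_filtermap eventually_sequentially by blast
  then show ?thesis
    using Q(2,3) by (intro exI[of _ n]) auto
next
  case False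
  then have "C u = 0"
    using a \<gamma> unfolding C_def by (smt (verit) mult_nonneg_nonneg of_nat_0_le_iff)
  then have M: "M t u = \<alpha>" for t
    by (simp add: M_def)
  have sub: "rank1_lattice a (B t) \<alpha> \<subseteq> rank1_lattice a (B t') \<alpha>" for t t'
  proof
    fix x assume "x \<in> rank1_lattice a (B t) \<alpha>"
    then obtain m k l where x: "x = vector [of_int m, of_int (a * m + \<alpha> * k), of_int (B t * m + \<alpha> * l)]"
      unfolding mem_rank1_lattice_iff by blast
    \<comment> \<open>\<open>B t\<close> and \<open>B t'\<close> differ by a multiple of \<alpha>,
      which the third generator absorbs.\<close>
    have "B t * m + \<alpha> * l = B t' * m + \<alpha> * (l + a * m * (int t - int t'))"
      by (simp add: B_def algebra_simps)
    then show "x \<in> rank1_lattice a (B t') \<alpha>"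
      unfolding mem_rank1_lattice_iff x by metis
  qed
  have "rank1_lattice a (B t) \<alpha> = rank1_lattice a (B t') \<alpha>" for t t'
    using sub by blast
  moreover obtain t0 where "\<alpha> < B t0"
    using eventually_B by (auto simp: eventually_sequentially)
  ultimately show ?thesis
    unfolding M using combinatorially_equivalent_refl by metis
qed

lemma u_stabilization:
  assumes "\<alpha> < B t"
  shows "\<exists>u0. \<forall>u>u0. combinatorially_equivalent
     (MV_lattice (rank1_lattice a (B t) (M t u))) (MV_lattice (rank1_lattice a (B t) (M t u0)))"
proof -
  let ?F = "filtermap (\<lambda>u. (t, u)) sequentially"
  have "filterlim (\<lambda>(t, u). real_of_int (C u)) at_top ?F"
    using filterlim_C by (simp add: filterlim_filtermap)
  then have "stable_pair ?F (\<lambda>p. real_of_int (B t)) (\<lambda>(t, u). real_of_int (C u))"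
    by (rule stable_pair_commute[OF stable_pair_at_top_const])
  then have "stable_pair ?F (\<lambda>(t, u). real_of_int (B t)) (\<lambda>(t, u). real_of_int (C u))"
    by (simp add: stable_pair_def sgn_stable_def eventually_filtermap)
  moreover have "\<forall>\<^sub>F (t, u) in ?F. \<alpha> < B t \<and> 1 \<le> C u"
    using eventually_C assms by (simp add: eventually_filtermap)
  ultimately obtain Q where Q: "eventually Q ?F" "\<And>t u. Q (t, u) \<Longrightarrow> \<alpha> < B t"
    "\<And>t u t' u'. Q (t, u) \<Longrightarrow> Q (t', u') \<Longrightarrow> combinatorially_equivalent
      (MV_lattice (rank1_lattice a (B t) (M t u))) (MV_lattice (rank1_lattice a (B t') (M t' u')))"
    by (rule eventually_equivalent) (rule that)
  obtain n where "\<forall>u\<ge>n. Q (t, u)"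
    using Q(1) unfolding eventually_filtermap eventually_sequentially by blast
  then show ?thesis
    using Q(3) by (intro exI[of _ n]) auto
qed

end

theorem theorem4p7:
  fixes a \<alpha> \<beta> \<gamma> :: int
    and b :: "nat \<Rightarrow> int" and N :: "nat \<Rightarrow> nat \<Rightarrow> int"
  assumes "1 \<le> a" and "1 \<le> \<alpha>"
    and "0 \<le> \<beta>" and "\<beta> < \<alpha> * a"
    and "0 \<le> \<gamma>" and "\<gamma> < a"
    and "gcd \<alpha> \<beta> = 1" and "gcd a (\<alpha> + \<beta> * \<gamma>) = 1"
    and b: "\<And>t. b t = \<alpha> * a * int t + \<beta>"
    and N: "\<And>t u. N t u = b t * (a * int u + \<gamma>) + \<alpha>"
  shows "(\<exists>t0 u0. \<alpha> < b t0 \<and>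
            (\<forall>t u. t > t0 \<and> u > u0 \<longrightarrow>
               combinatorially_equivalent
                 (MV_lattice (rank1_lattice a (b t) (N t u)))
                 (MV_lattice (rank1_lattice a (b t0) (N t0 u0)))))
       \<and> (\<forall>u. \<exists>t0. \<alpha> < b t0 \<and>
            (\<forall>t>t0.
               combinatorially_equivalent
                 (MV_lattice (rank1_lattice a (b t) (N t u)))
                 (MV_lattice (rank1_lattice a (b t0) (N t0 u)))))
       \<and> (\<forall>t. \<alpha> < b t \<longrightarrow>
            (\<exists>u0. \<forall>u>u0.
               combinatorially_equivalent
                 (MV_lattice (rank1_lattice a (b t) (N t u)))
                 (MV_lattice (rank1_lattice a (b t) (N t u0)))))"
proof -
  interpret lattice_family a \<alpha> \<beta> \<gamma>
    using assms by unfold_locales auto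
  have bB: "b = B"
    by (rule ext) (simp add: b B_def)
  have NM: "N = M"
    by (intro ext) (simp add: N M_def bB C_def)
  show ?thesis
    unfolding bB NM
    by (intro conjI allI impI tu_stabilization t_stabilization u_stabilization)
qed

end
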